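(* Let $q\ge 2$, $M>m\ge 0$, $\ell\le u$ and $n_0\ge \max\{-\ell/q^m,0\}$ be integers, and let $x\colon\mathbb{N}_0\to\mathbb{C}$ be a sequence for which there are constants $c_{s,k}\in\mathbb{C}$ ($0\le s<q^M$, $\ell\le k\le u$) such that \[x(q^Mn+s)=\sum_{\ell\le k\le u}c_{s,k}\,x(q^mn+k)\qquad\text{for all } n\ge n_0 \text{ and } 0\le s<q^M.\] Set \[\ell'\coloneqq\Big\lfloor\frac{(\ell+1)q^{M-m}-q^M}{q^{M-m}-1}\Big\rfloor\cdot[\ell<0],\qquad u'\coloneqq q^m-1+\Big\lceil\frac{u\,q^{M-m}}{q^{M-m}-1}\Big\rceil\cdot[u>0],\] and $n_1\coloneqq n_0-\lfloor \ell'/q^M\rfloor$. Using the convention $x(n)=0$ for $n<0$, define the vector-valued sequence $v$ as the concatenation of blocks $v_0,\dots,v_{M-1}$, where for $0\le j<m$ \[v_j=\big(x\circ(n\mapsto q^jn),\ x\circ(n\mapsto q^jn+1),\ \dots,\ x\circ(n\mapsto q^jn+q^j-1)\big)^\top,\] and for $m\le j<M$ \[v_j=\big(x\circ(n\mapsto q^jn+\ell'),\ x\circ(n\mapsto q^jn+\ell'+1),\ \dots,\ x\circ(n\mapsto q^jn+q^j-q^m+u')\big)^\top.\] Then $x$ is a component of $v$, and there exist square matrices $A_0,\dots,A_{q-1}$, depending only on $q,M,m,\ell,u$ and the coefficients $(c_{s,k})$ (in particular not on $n_0$), such that $v(qn+r)=A_rv(n)$ for all $0\le r<q$ and all $n\ge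 n_1$. In particular, $x$ is $q$-regular with offset $n_1$.
   Context: $[S]$ denotes the Iverson bracket ($1$ if $S$ is true, $0$ otherwise). A sequence $x\colon\mathbb{N}_0\to\mathbb{C}$ is called $q$-regular with offset $n_1$ if there are $D\in\mathbb{N}$, a sequence $w\colon\mathbb{N}_0\to\mathbb{C}^D$ whose first component is $x$, and matrices $A_0,\dots,A_{q-1}\in\mathbb{C}^{D\times D}$ with $w(qn+r)=A_rw(n)$ for all $0\le r<q$ and $n\ge n_1$ (a $q$-linear representation with offset $n_1$; if $x$ is a component of $w$ but not the first one, a permutation of components yields such a representation). *)

theory Defs
  imports Complex_Main "Jordan_Normal_Form.Matrix"
begin

(* The offset is an integer so that expressions such as n0 - \<lfloor>l' / q^M\<rfloor> need no truncation. *)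
definition q_regular_with_offset :: "nat \<Rightarrow> int \<Rightarrow> (nat \<Rightarrow> complex) \<Rightarrow> bool" where
  "q_regular_with_offset q n1 x \<longleftrightarrow>
     (\<exists>(D::nat) (w :: nat \<Rightarrow> complex vec) (A :: nat \<Rightarrow> complex mat).
        D > 0 \<and>
        (\<forall>n. w n \<in> carrier_vec D \<and> w n $ 0 = x n) \<and>
        (\<forall>r<q. A r \<in> carrier_mat D D) \<and>
        (\<forall>r<q. \<forall>n. int n \<ge> n1 \<longrightarrow> w (q * n + r) = A r *\<^sub>v w n))"

(* The convention x(n) = 0 for n < 0. *)
definition ext0 :: "(nat \<Rightarrow> complex) \<Rightarrow> int \<Rightarrow> complex" where
  "ext0 x n = (if n < 0 then 0 else x (nat n))"

(* The quantities l' and u'; of_bool is the Iverson bracket. *)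
definition lower_bound :: "nat \<Rightarrow> nat \<Rightarrow> nat \<Rightarrow> int \<Rightarrow> int" where
  "lower_bound q M m l =
     \<lfloor>((real_of_int l + 1) * real q ^ (M - m) - real q ^ M) / (real q ^ (M - m) - 1)\<rfloor>
       * of_bool (l < 0)"

definition upper_bound :: "nat \<Rightarrow> nat \<Rightarrow> nat \<Rightarrow> int \<Rightarrow> int" where
  "upper_bound q M m u =
     int q ^ m - 1
       + \<lceil>(real_of_int u * real q ^ (M - m)) / (real q ^ (M - m) - 1)\<rceil> * of_bool (u > 0)"

definition regular_offset :: "nat \<Rightarrow> nat \<Rightarrow> nat \<Rightarrow> int \<Rightarrow> int \<Rightarrow> int" where
  "regular_offset q M m l n0 = n0 - \<lfloor>real_of_int (lower_bound q M m l) / real q ^ M\<rfloor>"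

definition v_block ::
  "nat \<Rightarrow> nat \<Rightarrow> nat \<Rightarrow> int \<Rightarrow> int \<Rightarrow> (nat \<Rightarrow> complex) \<Rightarrow> nat \<Rightarrow> nat \<Rightarrow> complex list" where
  "v_block q M m l u x j n =
     map (\<lambda>b. ext0 x (int q ^ j * int n + b))
       (if j < m then [0 .. int q ^ j - 1]
        else [lower_bound q M m l .. int q ^ j - int q ^ m + upper_bound q M m u])"

definition v_seq ::
  "nat \<Rightarrow> nat \<Rightarrow> nat \<Rightarrow> int \<Rightarrow> int \<Rightarrow> (nat \<Rightarrow> complex) \<Rightarrow> nat \<Rightarrow> complex vec" where
  "v_seq q M m l u x n = vec_of_list (concat (map (\<lambda>j. v_block q M m l u x j n) [0..<M]))"

(* The index q^m * n + k is nonnegative whenever n \<ge> n0 \<ge> -l/q^m, so ext0 on the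
   right-hand side never yields a padded value in the situation of interest. *)
definition satisfies_recurrence ::
  "nat \<Rightarrow> nat \<Rightarrow> nat \<Rightarrow> int \<Rightarrow> int \<Rightarrow> (nat \<Rightarrow> int \<Rightarrow> complex) \<Rightarrow> int \<Rightarrow> (nat \<Rightarrow> complex) \<Rightarrow> bool" where
  "satisfies_recurrence q M m l u c n0 x \<longleftrightarrow>
     (\<forall>n. int n \<ge> n0 \<longrightarrow>
       (\<forall>s<q ^ M. x (q ^ M * n + s) = (\<Sum>k\<in>{l..u}. c s k * ext0 x (int q ^ m * int n + k))))"

end

theory Submission
  imports Defs
begin

text \<open>The entry \<open>x(q^j n + b)\<close> of \<open>v(n)\<close> becomes \<open>x(q^(j+1) n + q^j r + b)\<close> in \<open>v(q n + r)\<close>. For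
  \<open>j < M - 1\<close> this is an entry of the next block. For \<open>j = M - 1\<close>, write
  \<open>q^j r + b = q^M d + s\<close> with \<open>0 \<le> s < q^M\<close>; the recurrence at \<open>n + d\<close> produces the terms
  \<open>x(q^m n + q^m d + k)\<close>, and the bounds \<open>l'\<close> and \<open>u'\<close> are chosen such that
  \<open>l' \<le> q^m d + k \<le> u'\<close>, which makes them entries of the block of index \<open>m\<close>.\<close>

section \<open>Coordinates of the vector sequence \<open>v\<close>\<close>

text \<open>A pair (j, b) labels the entry x(q^j n + b). Keeping the labels apart from
  \<open>x\<close> and \<open>n\<close> lets the matrices be chosen from the parameters
  alone.\<close>

definition block_indices :: "nat \<Rightarrow> nat \<Rightarrow> nat \<Rightarrow> int \<Rightarrow> int \<Rightarrow> (nat \<times> int) list" where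
  "block_indices q M m l u = concat (map (\<lambda>j. map (Pair j)
       (if j < m then [0 .. int q ^ j - 1]
        else [lower_bound q M m l .. int q ^ j - int q ^ m + upper_bound q M m u])) [0..<M])"

lemma v_seq_eq_block_indices:
  "v_seq q M m l u x n =
     vec_of_list (map (\<lambda>(j, b). ext0 x (int q ^ j * int n + b)) (block_indices q M m l u))"
  unfolding v_seq_def v_block_def block_indices_def map_concat by (simp add: o_def)

lemma mem_block_indices:
  "(j, b) \<in> set (block_indices q M m l u) \<longleftrightarrow> j < M \<and>
     (if j < m then 0 \<le> b \<and> b < int q ^ j
      else lower_bound q M m l \<le> b \<and> b \<le> int q ^ j - int q ^ m + upper_bound q M m u)"
  by (auto simp: block_indices_def intro!: bexI[of _ j])

lemma v_seq_nth:
  assumes "i < length (block_indices q M m l u)"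
    and "block_indices q M m l u ! i = (j, b)"
  shows "v_seq q M m l u x n $ i = ext0 x (int q ^ j * int n + b)"
  using assms by (simp add: v_seq_eq_block_indices vec_of_list_index)

text \<open>The position is chosen before \<open>x\<close> and \<open>n\<close>, so row coefficients
  built from it serve all sequences and all arguments.\<close>

lemma block_indices_nth_ex:
  assumes "(j, b) \<in> set (block_indices q M m l u)"
  shows "\<exists>i<length (block_indices q M m l u).
    \<forall>x n. v_seq q M m l u x n $ i = ext0 x (int q ^ j * int n + b)"
proof -
  obtain i where "i < length (block_indices q M m l u)" "block_indices q M m l u ! i = (j, b)"
    using assms unfolding in_set_conv_nth by blast
  then show ?thesis
    using v_seq_nth by blast
qed

lemma v_seq_carrier: "v_seq q M m l u x n \<in> carrier_vec (length (block_indices q M m l u))"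
  by (rule carrier_vecI) (simp add: v_seq_eq_block_indices)

section \<open>Estimates for the bounds l' and u'\<close>

lemma one_less_int_power:
  assumes "q \<ge> 2" "e > 0"
  shows "1 < int q ^ e"
  using assms by (intro one_less_power) auto

text \<open>Together with \<open>upper_bound_ge\<close>, this places 0, ..., q^m - 1 in the block of
  index \<open>m\<close>, which can therefore receive the entries coming from the block before
  it.\<close>

lemma lower_bound_nonpos:
  assumes "q \<ge> 2" "M > m"
  shows "lower_bound q M m l \<le> 0"
proof (cases "l < 0")
  case True
  have Q: "real q ^ (M - m) > 1"
    using assms by (intro one_less_power) auto
  have "(real_of_int l + 1) * real q ^ (M - m) \<le> 0"
    using True Q by (intro mult_nonpos_nonneg) auto
  then have "(real_of_int l + 1) * real q ^ (M - m) - real q ^ M \<le> 0"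
    using zero_le_power[of "real q" M] by linarith
  then have "((real_of_int l + 1) * real q ^ (M - m) - real q ^ M) / (real q ^ (M - m) - 1) \<le> 0"
    using Q by (intro divide_nonpos_pos) simp_all
  then show ?thesis
    using True by (simp add: lower_bound_def floor_le_iff)
qed (simp add: lower_bound_def)

text \<open>Clearing the positive denominator under the floor leaves a purely integral
  inequality.\<close>

lemma lower_bound_mult_le:
  assumes "q \<ge> 2" "M > m" "l < 0"
  shows "lower_bound q M m l * (int q ^ (M - m) - 1) \<le> (l + 1) * int q ^ (M - m) - int q ^ M"
proof -
  have Q: "real q ^ (M - m) > 1"
    using assms by (intro one_less_power) auto
  have "real_of_int (lower_bound q M m l)
      \<le> ((real_of_int l + 1) * real q ^ (M - m) - real q ^ M) / (real q ^ (M - m) - 1)"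
    using assms by (simp add: lower_bound_def)
  then have "real_of_int (lower_bound q M m l) * (real q ^ (M - m) - 1)
      \<le> (real_of_int l + 1) * real q ^ (M - m) - real q ^ M"
    using Q by (simp add: le_divide_eq)
  then have "real_of_int (lower_bound q M m l * (int q ^ (M - m) - 1))
      \<le> real_of_int ((l + 1) * int q ^ (M - m) - int q ^ M)"
    by simp
  then show ?thesis
    unfolding of_int_le_iff .
qed

lemma upper_bound_ge:
  assumes "q \<ge> 2" "M > m"
  shows "upper_bound q M m u \<ge> int q ^ m - 1"
proof (cases "u > 0")
  case True
  have Q: "real q ^ (M - m) > 1"
    using assms by (intro one_less_power) auto
  have "0 \<le> (real_of_int u * real q ^ (M - m)) / (real q ^ (M - m) - 1)"
    using Q True by auto
  then have "0 \<le> \<lceil>(real_of_int u * real q ^ (M - m)) / (real q ^ (M - m) - 1)\<rceil>"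
    by linarith
  then show ?thesis
    using True by (simp add: upper_bound_def)
qed (simp add: upper_bound_def)

lemma upper_bound_mult_ge:
  assumes "q \<ge> 2" "M > m" "u > 0"
  shows "(upper_bound q M m u - int q ^ m + 1) * (int q ^ (M - m) - 1) \<ge> u * int q ^ (M - m)"
proof -
  have Q: "real q ^ (M - m) > 1"
    using assms by (intro one_less_power) auto
  have "real_of_int (upper_bound q M m u - int q ^ m + 1)
      \<ge> (real_of_int u * real q ^ (M - m)) / (real q ^ (M - m) - 1)"
    using assms by (simp add: upper_bound_def)
  then have "real_of_int (upper_bound q M m u - int q ^ m + 1) * (real q ^ (M - m) - 1)
      \<ge> real_of_int u * real q ^ (M - m)"
    using Q by (simp add: divide_le_eq)
  then have "real_of_int ((upper_bound q M m u - int q ^ m + 1) * (int q ^ (M - m) - 1))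
      \<ge> real_of_int (u * int q ^ (M - m))"
    by simp
  then show ?thesis
    unfolding of_int_le_iff .
qed

text \<open>Since l' mod q^M is at most q^M - 1, the hypothesis on \<open>d\<close> gives q^M d
  \<ge> l' - q^M + 1. Adding the inequality that defines l' and dividing by q^(M-m) yields the claim
  when \<open>l\<close> is negative; otherwise l' = 0 and both summands are nonnegative.\<close>

lemma lower_bound_le_shift:
  assumes "q \<ge> 2" "M > m" and d: "d \<ge> lower_bound q M m l div int q ^ M" and "k \<ge> l"
  shows "lower_bound q M m l \<le> int q ^ m * d + k"
proof (cases "l < 0")
  case True
  define L P Q where "L = lower_bound q M m l" and "P = int q ^ m" and "Q = int q ^ (M - m)"
  have PQ: "int q ^ M = P * Q"
    using assms by (simp add: P_def Q_def flip: power_add)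
  have Q: "Q > 1"
    unfolding Q_def using assms by (intro one_less_int_power) auto
  have P: "P > 0"
    unfolding P_def using assms by simp
  have key: "L * (Q - 1) \<le> (l + 1) * Q - P * Q"
    using lower_bound_mult_le[OF assms(1,2) True] by (simp add: L_def PQ flip: Q_def)
  have "L mod (P * Q) < P * Q"
    using P Q by simp
  then have "L \<le> P * Q * (L div (P * Q)) + (P * Q - 1)"
    using mult_div_mod_eq[of "P * Q" L] by linarith
  also have "P * Q * (L div (P * Q)) \<le> P * Q * d"
    using d P Q by (intro mult_left_mono) (auto simp: L_def PQ)
  \<comment> \<open>The 1 gained from the remainder makes this strict; after division by
    \<open>Q\<close>, strictness lowers \<open>l + 1\<close> to \<open>l\<close>.\<close>
  finally have "L * Q < Q * (P * d + l + 1)"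
    using key by (simp add: algebra_simps)
  then have "L < P * d + l + 1"
    using Q by (simp add: mult.commute)
  then show ?thesis
    using \<open>k \<ge> l\<close> by (simp add: L_def P_def)
next
  case False
  then have "lower_bound q M m l = 0"
    by (simp add: lower_bound_def)
  then show ?thesis
    using False d \<open>k \<ge> l\<close> by simp
qed

text \<open>Mirror image of \<open>lower_bound_le_shift\<close>: add the inequality that defines u'
  to the bound on q^M d, then divide by q^(M-m).\<close>

lemma shift_le_upper_bound:
  assumes "q \<ge> 2" "M > m" and d: "int q ^ M * d \<le> int q ^ M - int q ^ m + upper_bound q M m u"
    and "k \<le> u"
  shows "int q ^ m * d + k \<le> upper_bound q M m u"
proof (cases "u > 0")
  case True
  \<comment> \<open>\<open>C\<close> is the ceiling in the definition of u'.\<close>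
  define C P Q where "C = upper_bound q M m u - int q ^ m + 1" and "P = int q ^ m"
    and "Q = int q ^ (M - m)"
  have PQ: "int q ^ M = P * Q"
    using assms by (simp add: P_def Q_def flip: power_add)
  have Q: "Q > 1"
    unfolding Q_def using assms by (intro one_less_int_power) auto
  have key: "C * (Q - 1) \<ge> u * Q"
    using upper_bound_mult_ge[OF assms(1,2) True] by (simp add: C_def flip: Q_def)
  have "P * Q * d \<le> P * Q - 1 + C"
    using d by (simp add: C_def PQ)
  then have "Q * (P * d + u) < Q * (P + C)"
    using key by (simp add: algebra_simps)
  then have "P * d + u < P + C"
    using Q by simp
  then show ?thesis
    using \<open>k \<le> u\<close> by (simp add: C_def P_def)
next
  case False
  then have U: "upper_bound q M m u = int q ^ m - 1"
    by (simp add: upper_bound_def)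
  \<comment> \<open>The hypothesis now reads q^M d \<le> q^M - 1, which excludes every positive
    \<open>d\<close>.\<close>
  have "int q ^ M * d < int q ^ M * 1"
    using d by (simp add: U)
  then have "d \<le> 0"
    using assms(1) by (simp add: mult_less_cancel_left)
  then have "int q ^ m * d \<le> 0"
    by (simp add: mult_nonneg_nonpos)
  moreover have "int q ^ m \<ge> 1"
    using assms(1) by simp
  ultimately show ?thesis
    using False \<open>k \<le> u\<close> U by linarith
qed

section \<open>Construction of the matrices\<close>

text \<open>The inner sum collects the coefficients of all \<open>k\<close> sent to the same
  position, giving a full matrix row that does not depend on \<open>w\<close>.\<close>

lemma sum_entries_eq_row_mult:
  fixes c :: "'a \<Rightarrow> complex" and D :: nat
  assumes "finite K" "\<And>k. k \<in> K \<Longrightarrow> p k < D"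
  shows "(\<Sum>k\<in>K. c k * w (p k)) = (\<Sum>i<D. (\<Sum>k\<in>K. c k * of_bool (i = p k)) * w i)"
proof -
  have "(\<Sum>i<D. (\<Sum>k\<in>K. c k * of_bool (i = p k)) * w i)
      = (\<Sum>k\<in>K. \<Sum>i<D. if i = p k then c k * w i else 0)"
    unfolding sum_distrib_right by (subst sum.swap) (intro sum.cong, auto)
  also have "\<dots> = (\<Sum>k\<in>K. c k * w (p k))"
    using assms by (intro sum.cong) (auto simp: sum.delta')
  finally show ?thesis ..
qed

lemma ext0_of_nat: "ext0 x (int n) = x n"
  by (simp add: ext0_def)

text \<open>The recurrence will be applied at n + d with \<open>d\<close> possibly negative, hence
  this form with an integer argument.\<close>

lemma recurrence_ext0:
  assumes "satisfies_recurrence q M m l u c n0 x" "n0 \<ge> 0" "N \<ge> n0" "s < q ^ M"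
  shows "ext0 x (int q ^ M * N + int s) = (\<Sum>k\<in>{l..u}. c s k * ext0 x (int q ^ m * N + k))"
proof -
  have N: "N = int (nat N)"
    using assms by simp
  then have "int q ^ M * N + int s = int (q ^ M * nat N + s)"
    by simp
  then have "ext0 x (int q ^ M * N + int s) = x (q ^ M * nat N + s)"
    by (simp only: ext0_of_nat)
  also have "\<dots> = (\<Sum>k\<in>{l..u}. c s k * ext0 x (int q ^ m * int (nat N) + k))"
    using assms by (auto simp: satisfies_recurrence_def)
  finally show ?thesis
    using N by simp
qed

text \<open>The order of the quantifiers matters: one row \<open>f\<close> serves every
  \<open>n0\<close>, \<open>x\<close> and \<open>n\<close>.\<close>

lemma v_seq_row_ex:
  assumes "q \<ge> 2" "M > m" "r < q" and jb: "(j, b) \<in> set (block_indices q M m l u)"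
  defines "D \<equiv> length (block_indices q M m l u)"
  shows "\<exists>f. \<forall>n0 x n. n0 \<ge> 0 \<longrightarrow> satisfies_recurrence q M m l u c n0 x \<longrightarrow>
     int n \<ge> regular_offset q M m l n0 \<longrightarrow>
     ext0 x (int q ^ j * int (q * n + r) + b) = (\<Sum>i<D. f i * v_seq q M m l u x n $ i)"
proof -
  define t where "t = int q ^ j * int r + b"
  have shift: "int q ^ j * int (q * n + r) + b = int q ^ Suc j * int n + t" for n
    by (simp add: t_def algebra_simps)
  \<comment> \<open>For j \<ge> m, the maximal increment q^(j+1) - q^j is exactly the growth of the
    upper end from block j to block j + 1.\<close>
  have r: "0 \<le> int q ^ j * int r" "int q ^ j * int r \<le> int q ^ Suc j - int q ^ j"
    using mult_left_mono[of "int r" "int q - 1" "int q ^ j"] \<open>r < q\<close> by (auto simp: algebra_simps)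
  have jM: "j < M"
    using jb by (simp add: mem_block_indices)
  show ?thesis
  proof (cases "Suc j = M")
    case False
    have "(Suc j, t) \<in> set (block_indices q M m l u)"
    proof (cases "j < m")
      case True
      then have "0 \<le> t" "t < int q ^ Suc j"
        using jb r by (auto simp: mem_block_indices t_def)
      \<comment> \<open>At the passage from j = m - 1 to \<open>m\<close> the shape of the blocks
        changes, and the upper end becomes u' \<ge> q^m - 1.\<close>
      moreover have "t \<le> upper_bound q M m u" if "Suc j = m"
        using upper_bound_ge[OF assms(1,2), of u] \<open>t < int q ^ Suc j\<close> that by simp
      ultimately show ?thesis
        using lower_bound_nonpos[OF assms(1,2), of l] False True jM
        by (auto simp: mem_block_indices not_less_eq less_Suc_eq)
    next
      case j: False
      then have "lower_bound q M m l \<le> b" "b \<le> int q ^ j - int q ^ m + upper_bound q M m u"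
        using jb by (simp_all add: mem_block_indices)
      then have "lower_bound q M m l \<le> t" "t \<le> int q ^ Suc j - int q ^ m + upper_bound q M m u"
        using r unfolding t_def by linarith+
      then show ?thesis
        using j False jM by (simp add: mem_block_indices)
    qed
    then obtain i where "i < D" and
      i: "\<And>x n. v_seq q M m l u x n $ i = ext0 x (int q ^ Suc j * int n + t)"
      using block_indices_nth_ex unfolding D_def by meson
    then have "ext0 x (int q ^ Suc j * int n + t)
        = (\<Sum>i'<D. of_bool (i' = i) * v_seq q M m l u x n $ i')" for x n
      using sum_entries_eq_row_mult[of "{i}" "\<lambda>k. k" D "\<lambda>_. 1" "\<lambda>i. v_seq q M m l u x n $ i"]
      by simp
    then show ?thesis
      unfolding shift by (intro exI[of _ "\<lambda>i'. of_bool (i' = i)"]) simp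
  next
    case True
    \<comment> \<open>Floor division, so that \<open>s\<close> is a valid residue even if
      \<open>t\<close> is negative; then \<open>d\<close> is negative too.\<close>
    define d s where "d = t div int q ^ M" and "s = nat (t mod int q ^ M)"
    have qM: "int q ^ M > 0"
      using assms(1) by simp
    have s: "s < q ^ M" "int s = t mod int q ^ M"
      using qM by (simp_all add: s_def nat_less_iff)
    have t: "t = int q ^ M * d + int s"
      by (simp add: d_def s)
    have "lower_bound q M m l \<le> b" "b \<le> int q ^ j - int q ^ m + upper_bound q M m u"
      using jb True \<open>M > m\<close> by (auto simp: mem_block_indices)
    then have bounds: "lower_bound q M m l \<le> t"
      "t \<le> int q ^ M - int q ^ m + upper_bound q M m u"
      using r unfolding t_def True by linarith+
    have "d \<ge> lower_bound q M m l div int q ^ M"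
      using bounds qM by (simp add: d_def zdiv_mono1)
    moreover have "int q ^ M * d \<le> int q ^ M - int q ^ m + upper_bound q M m u"
      using bounds t by linarith
    ultimately have mem: "(m, int q ^ m * d + k) \<in> set (block_indices q M m l u)" if "k \<in> {l..u}" for k
      using that assms(1,2) lower_bound_le_shift[of q m M l d k] shift_le_upper_bound[of q m M d u k]
      by (simp add: mem_block_indices)
    have "\<exists>i<D. \<forall>x n. v_seq q M m l u x n $ i = ext0 x (int q ^ m * int n + (int q ^ m * d + k))"
      if "k \<in> {l..u}" for k
      using block_indices_nth_ex[OF mem[OF that]] unfolding D_def .
    then obtain p where p: "\<And>k. k \<in> {l..u} \<Longrightarrow> p k < D"
      "\<And>k x n. k \<in> {l..u} \<Longrightarrow>
         v_seq q M m l u x n $ p k = ext0 x (int q ^ m * int n + (int q ^ m * d + k))"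
      by metis
    have "ext0 x (int q ^ Suc j * int n + t)
        = (\<Sum>i<D. (\<Sum>k\<in>{l..u}. c s k * of_bool (i = p k)) * v_seq q M m l u x n $ i)"
      if "n0 \<ge> 0" "satisfies_recurrence q M m l u c n0 x" "int n \<ge> regular_offset q M m l n0"
      for n0 x n
    proof -
      have "\<lfloor>real_of_int (lower_bound q M m l) / real q ^ M\<rfloor> = lower_bound q M m l div int q ^ M"
        using floor_divide_of_int_eq[of "lower_bound q M m l" "int q ^ M"] by simp
      \<comment> \<open>This is where the offset comes from: subtracting the lower bound for
        \<open>d\<close> from \<open>n0\<close> keeps the shifted argument in the range of the
        recurrence.\<close>
      then have N: "int n + d \<ge> n0"
        using that(3) \<open>d \<ge> _\<close> by (simp add: regular_offset_def)
      have "ext0 x (int q ^ Suc j * int n + t) = ext0 x (int q ^ M * (int n + d) + int s)"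
        unfolding True t by (simp add: algebra_simps)
      also have "\<dots> = (\<Sum>k\<in>{l..u}. c s k * ext0 x (int q ^ m * (int n + d) + k))"
        using recurrence_ext0[OF that(2,1) N s(1)] .
      also have "\<dots> = (\<Sum>k\<in>{l..u}. c s k * v_seq q M m l u x n $ p k)"
        by (intro sum.cong) (simp_all add: p(2) algebra_simps)
      also have "\<dots> = (\<Sum>i<D. (\<Sum>k\<in>{l..u}. c s k * of_bool (i = p k)) * v_seq q M m l u x n $ i)"
        by (rule sum_entries_eq_row_mult) (auto simp: p(1))
      finally show ?thesis .
    qed
    then show ?thesis
      unfolding shift
      by (intro exI[of _ "\<lambda>i. \<Sum>k\<in>{l..u}. c s k * of_bool (i = p k)"] allI impI)
  qed
qed

lemma v_seq_matrices_ex: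
  fixes l u :: int
  assumes "q \<ge> 2" "M > m"
  defines "D \<equiv> length (block_indices q M m l u)"
  obtains A where "\<And>r. r < q \<Longrightarrow> A r \<in> carrier_mat D D"
    and "\<And>n0 x r n. n0 \<ge> 0 \<Longrightarrow> satisfies_recurrence q M m l u c n0 x \<Longrightarrow> r < q \<Longrightarrow>
      int n \<ge> regular_offset q M m l n0 \<Longrightarrow>
      v_seq q M m l u x (q * n + r) = A r *\<^sub>v v_seq q M m l u x n"
proof -
  \<comment> \<open>The condition covers all \<open>n0\<close>, \<open>x\<close> and
    \<open>n\<close> at once, so the coefficients \<open>F\<close> chosen from it depend only on
    \<open>r\<close> and \<open>i\<close>.\<close>
  define row where "row r i f \<longleftrightarrow>
    (\<forall>n0 x n. n0 \<ge> 0 \<longrightarrow> satisfies_recurrence q M m l u c n0 x \<longrightarrow>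
       int n \<ge> regular_offset q M m l n0 \<longrightarrow>
       v_seq q M m l u x (q * n + r) $ i = (\<Sum>k<D. f k * v_seq q M m l u x n $ k))" for r i f
  have "\<exists>f. row r i f"
    if "r < q" "i < D" for r i
  proof -
    obtain j b where jb: "block_indices q M m l u ! i = (j, b)"
      by fastforce
    then have "(j, b) \<in> set (block_indices q M m l u)"
      using that by (metis D_def nth_mem)
    from v_seq_row_ex[OF assms(1,2) that(1) this, of c] show ?thesis
      using v_seq_nth[OF that(2)[unfolded D_def] jb] by (simp add: D_def row_def)
  qed
  then obtain F where "\<And>r i. r < q \<Longrightarrow> i < D \<Longrightarrow> row r i (F r i)"
    by metis
  then have F: "\<And>r i n0 x n. r < q \<Longrightarrow> i < D \<Longrightarrow> n0 \<ge> 0 \<Longrightarrow>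
     satisfies_recurrence q M m l u c n0 x \<Longrightarrow> int n \<ge> regular_offset q M m l n0 \<Longrightarrow>
     v_seq q M m l u x (q * n + r) $ i = (\<Sum>k<D. F r i k * v_seq q M m l u x n $ k)"
    unfolding row_def by blast
  have dim: "dim_vec (v_seq q M m l u x n) = D" for x n
    unfolding D_def by (rule carrier_vecD[OF v_seq_carrier])
  show ?thesis
  proof
    show "mat D D (\<lambda>(i, k). F r i k) \<in> carrier_mat D D" for r
      by simp
    show "v_seq q M m l u x (q * n + r) = mat D D (\<lambda>(i, k). F r i k) *\<^sub>v v_seq q M m l u x n"
      if "n0 \<ge> 0" "satisfies_recurrence q M m l u c n0 x" "r < q"
        "int n \<ge> regular_offset q M m l n0" for n0 x r n
      using F[OF that(3) _ that(1,2,4)]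
      by (intro eq_vecI) (simp_all add: dim scalar_prod_def lessThan_atLeast0)
  qed
qed

section \<open>Moving \<open>x\<close> to the first component\<close>

text \<open>Swapping the components 0 and \<open>i\<close> conjugates each matrix by a permutation
  matrix and preserves the recursion.\<close>

lemma q_regular_with_offsetI:
  assumes "i < D" "\<And>n. w n \<in> carrier_vec D" "\<And>n. w n $ i = x n"
    and "\<And>r. r < q \<Longrightarrow> A r \<in> carrier_mat D D"
    and rec: "\<And>r n. r < q \<Longrightarrow> int n \<ge> n1 \<Longrightarrow> w (q * n + r) = A r *\<^sub>v w n"
  shows "q_regular_with_offset q n1 x"
proof -
  define \<sigma> where "\<sigma> k = (if k = 0 then i else if k = i then 0 else k)" for k
  have \<sigma>: "\<sigma> k < D" "\<sigma> (\<sigma> k) = k" if "k < D" for k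
    using that \<open>i < D\<close> by (auto simp: \<sigma>_def)
  define w' where "w' n = vec D (\<lambda>k. w n $ \<sigma> k)" for n
  define A' where "A' r = mat D D (\<lambda>(a, b). A r $$ (\<sigma> a, \<sigma> b))" for r
  have "w' (q * n + r) = A' r *\<^sub>v w' n" if "r < q" "int n \<ge> n1" for r n
  proof (rule eq_vecI)
    fix a assume "a < dim_vec (A' r *\<^sub>v w' n)"
    then have a: "a < D"
      by (simp add: A'_def)
    have "w' (q * n + r) $ a = (\<Sum>b<D. A r $$ (\<sigma> a, b) * w n $ b)"
      using a \<sigma>(1)[OF a] rec[OF that] assms(2)[of n] assms(4)[OF that(1)]
      by (simp add: w'_def scalar_prod_def lessThan_atLeast0)
    \<comment> \<open>Reindexing by \<sigma>, which is its own inverse on the indices below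
      \<open>D\<close>.\<close>
    also have "\<dots> = (\<Sum>b<D. A r $$ (\<sigma> a, \<sigma> b) * w n $ \<sigma> b)"
      by (rule sum.reindex_bij_witness[of _ \<sigma> \<sigma>]) (auto simp: \<sigma>)
    also have "\<dots> = (A' r *\<^sub>v w' n) $ a"
      using a by (simp add: A'_def w'_def scalar_prod_def lessThan_atLeast0)
    finally show "w' (q * n + r) $ a = (A' r *\<^sub>v w' n) $ a" .
  qed (simp add: w'_def A'_def)
  moreover have "w' n \<in> carrier_vec D \<and> w' n $ 0 = x n" for n
    using assms(1,3) by (simp add: w'_def \<sigma>_def)
  moreover have "A' r \<in> carrier_mat D D" for r
    by (simp add: A'_def)
  ultimately show ?thesis
    unfolding q_regular_with_offset_def using \<open>i < D\<close> by (metis gr_zeroI not_less_zero)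
qed

theorem theorem3p6:
  fixes q M m :: nat and l u :: int and c :: "nat \<Rightarrow> int \<Rightarrow> complex"
  assumes "q \<ge> 2" and "M > m" and "l \<le> u"
  shows "\<exists>(D::nat) (A :: nat \<Rightarrow> complex mat).
    (\<forall>r<q. A r \<in> carrier_mat D D) \<and>
    (\<forall>(n0::int) (x :: nat \<Rightarrow> complex).
       real_of_int n0 \<ge> max (- real_of_int l / real q ^ m) 0 \<longrightarrow>
       satisfies_recurrence q M m l u c n0 x \<longrightarrow>
         (\<forall>n. v_seq q M m l u x n \<in> carrier_vec D) \<and>
         (\<exists>i<D. \<forall>n. v_seq q M m l u x n $ i = x n) \<and>
         (\<forall>r<q. \<forall>n. int n \<ge> regular_offset q M m l n0 \<longrightarrow>
            v_seq q M m l u x (q * n + r) = A r *\<^sub>v v_seq q M m l u x n) \<and>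
         q_regular_with_offset q (regular_offset q M m l n0) x)"
proof -
  define D where "D = length (block_indices q M m l u)"
  obtain A where A: "\<And>r. r < q \<Longrightarrow> A r \<in> carrier_mat D D"
    "\<And>n0 x r n. n0 \<ge> 0 \<Longrightarrow> satisfies_recurrence q M m l u c n0 x \<Longrightarrow> r < q \<Longrightarrow>
      int n \<ge> regular_offset q M m l n0 \<Longrightarrow>
      v_seq q M m l u x (q * n + r) = A r *\<^sub>v v_seq q M m l u x n"
    using v_seq_matrices_ex[OF assms(1,2), of l u c, folded D_def] by blast
  \<comment> \<open>The label (0, 0) stands for x(n). If \<open>m\<close> = 0, the first block
    already has the second shape, and l' \<le> 0 \<le> u' is needed.\<close>
  have "(0, 0) \<in> set (block_indices q M m l u)"
    using lower_bound_nonpos[OF assms(1,2), of l] upper_bound_ge[OF assms(1,2), of u] assms(2)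
    by (auto simp: mem_block_indices)
  then obtain i where "i < D"
    "\<And>x n. v_seq q M m l u x n $ i = ext0 x (int q ^ 0 * int n + 0)"
    using block_indices_nth_ex unfolding D_def by meson
  then have i: "i < D" "v_seq q M m l u x n $ i = x n" for x n
    by (simp_all add: ext0_of_nat)
  have carrier: "v_seq q M m l u x n \<in> carrier_vec D" for x n
    unfolding D_def by (rule v_seq_carrier)
  show ?thesis
  proof (rule exI[of _ D], rule exI[of _ A], intro conjI allI impI)
    fix n0 x
    assume "real_of_int n0 \<ge> max (- real_of_int l / real q ^ m) 0"
      and rec: "satisfies_recurrence q M m l u c n0 x"
    then have n0: "n0 \<ge> 0"
      by simp
    show "\<exists>i<D. \<forall>n. v_seq q M m l u x n $ i = x n"
      using i by blast
    show "q_regular_with_offset q (regular_offset q M m l n0) x"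
      by (rule q_regular_with_offsetI[OF i(1) carrier i(2) A(1) A(2)[OF n0 rec]])
    show "v_seq q M m l u x (q * n + r) = A r *\<^sub>v v_seq q M m l u x n"
      if "r < q" "int n \<ge> regular_offset q M m l n0" for r n
      using A(2)[OF n0 rec that] .
  qed (use A(1) carrier in auto)
qed

end
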